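(* Let $\mathcal V$ be a commutative quantale and $H:\mathsf{Set}\to\mathcal V\text{-}\mathsf{cat}$ a functor. The following are equivalent. (1) The unit $H\to(\mathrm{Lan}_DH)D$ of the $\mathcal V\text{-}\mathsf{cat}$-enriched left Kan extension of $H$ along the discrete functor $D:\mathsf{Set}\to\mathcal V\text{-}\mathsf{cat}$ is an isomorphism. (2) Self-distances on elements of $H\emptyset$ are $\top$. (3) All self-distances of all constants of $H$ are $\top$. (4) $H$ preserves $\mathcal V$-nerves of sets. Moreover, these conditions always hold if $\mathcal V$ is integral, or, for general $\mathcal V$, if $H\emptyset=\emptyset$.
   Context: $\mathcal V=(\mathcal V_o,\otimes,e,[-,-])$ is a commutative quantale: a complete lattice with a commutative, associative, monotone operation $\otimes$ with unit $e$, such that each $-\otimes r$ has a right adjoint $[r,-]$; $\mathcal V$ is assumed non-trivial ($e\neq\bot$). It is integral if $e=\top$. A (small) $\mathcal V$-category $\mathcal X$ is a set of objects together with elements $\mathcal X(x',x)\in\mathcal V_o$ satisfying $e\le\mathcal X(x,x)$ and $\mathcal X(x',x)\otimes\mathcal X(x'',x')\le\mathcal X(x'',x)$; the self-distance of $x$ is $\mathcal X(x,x)$. A $\mathcal V$-functor $f:\mathcal X\to\mathcal Y$ is a map on objects with $\mathcal X(x',x)\le\mathcal Y(fx',fx)$. $\mathcal V\text{-}\mathsf{cat}$ is the symmetric monoidal closed category of small $\mathcal V$-categories and $\mathcal V$-functors, with $(\mathcal X\otimes\mathcal Y)((x',y'),(x,y))=\mathcal X(x',x)\otimes\mathcal Y(y',y)$,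 unit $\mathbb 1$ (one object $0$ with $\mathbb 1(0,0)=e$), and internal hom $[\mathcal Y,\mathcal Z]=\mathcal V\text{-}\mathsf{cat}(\mathcal Y,\mathcal Z)$ of $\mathcal V$-functors with $[\mathcal Y,\mathcal Z](f,g)=\bigwedge_y\mathcal Z(fy,gy)$; it is enriched over itself. $\mathsf{Set}$ is regarded as a $\mathcal V\text{-}\mathsf{cat}$-category whose homs are the discrete $\mathcal V$-categories (distance $e$ between equal objects, $\bot$ otherwise) on the sets of functions, so ordinary functors out of $\mathsf{Set}$ are automatically $\mathcal V\text{-}\mathsf{cat}$-functors; $D$ sends a set to the discrete $\mathcal V$-category on it. $\mathrm{Lan}_DH$ is the enriched left Kan extension, $(\mathrm{Lan}_DH)\mathcal X\cong\mathcal V\text{-}\mathsf{cat}(D-,\mathcal X)*H$ (weighted colimit); it always exists. A constant of $H:\mathsf{Set}\to\mathcal V\text{-}\mathsf{cat}$ is a natural transformation $\tau:\mathbb 1\to H$ from the constant functor with value $\mathbb 1$; constants form a $\mathcal V$-category with distances $\bigwedge_X[\mathbb 1,HX](\sigma_X,\tau_X)$. For a set $X$ and $r\in\mathcal V_o$ put $(DX)_r=\{(x',x)\in X\times X\mid r\le DX(x',x)\}$ with projections $d^r_0,d^r_1:(DX)_r\to X$. $H$ preserves $\mathcal V$-nerves of sets if for every set $X$ the identity $\mathcal V$-functor on $HX$ is a cocone over the $\mathcal V$-nerve diagram of $DX$, i.e. $r\le\bigwedge_{C\in H((DX)_r)}HX(Hd^r_0(C),Hd^r_1(C))$ for all sets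 $X$ and all $r\in\mathcal V_o$ (with $C$ ranging over the objects of the $\mathcal V$-category $H((DX)_r)$). *)

theory Defs
  imports Main "HOL-Library.FuncSet"
begin

text \<open>
  A non-trivial commutative quantale: \<open>\<otimes>\<close> is \<open>*\<close>, the unit \<open>e\<close> is \<open>1\<close>, and \<open>residual r\<close> is the
  right adjoint \<open>[r,-]\<close> of \<open>- * r\<close>.  Monotonicity of \<open>*\<close> follows from the adjunction.
\<close>

class commutative_quantale = complete_lattice + comm_monoid_mult +
  fixes residual :: "'a \<Rightarrow> 'a \<Rightarrow> 'a"
  assumes residuated: "x * r \<le> s \<longleftrightarrow> x \<le> residual r s"
    and nontrivial: "1 \<noteq> bot"

definition integral_quantale :: "'v::commutative_quantale itself \<Rightarrow> bool" where
  "integral_quantale _ \<longleftrightarrow> (1 :: 'v) = top"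


section \<open>\<open>\<V>\<close>-categories\<close>

text \<open>The values of \<open>Hom\<close> outside \<open>Obj\<close> are irrelevant; maps are extensional functions.\<close>

record ('a, 'v) vcat =
  Obj :: "'a set"
  Hom :: "'a \<Rightarrow> 'a \<Rightarrow> 'v"

definition vcategory :: "('a, 'v::commutative_quantale) vcat \<Rightarrow> bool" where
  "vcategory A \<longleftrightarrow>
     (\<forall>x\<in>Obj A. 1 \<le> Hom A x x) \<and>
     (\<forall>x\<in>Obj A. \<forall>x'\<in>Obj A. \<forall>x''\<in>Obj A. Hom A x' x * Hom A x'' x' \<le> Hom A x'' x)"

definition vfun :: "('a, 'v::commutative_quantale) vcat \<Rightarrow> ('b, 'v) vcat \<Rightarrow> ('a \<Rightarrow> 'b) set" where
  "vfun A B = {f \<in> Obj A \<rightarrow>\<^sub>E Obj B. \<forall>x'\<in>Obj A. \<forall>x\<in>Obj A. Hom A x' x \<le> Hom B (f x') (f x)}"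

definition vcat_iso ::
    "('a, 'v::commutative_quantale) vcat \<Rightarrow> ('b, 'v) vcat \<Rightarrow> ('a \<Rightarrow> 'b) \<Rightarrow> bool" where
  "vcat_iso A B f \<longleftrightarrow> f \<in> vfun A B \<and>
     (\<exists>g\<in>vfun B A. (\<forall>x\<in>Obj A. g (f x) = x) \<and> (\<forall>y\<in>Obj B. f (g y) = y))"

definition ihom ::
    "('a, 'v::commutative_quantale) vcat \<Rightarrow> ('b, 'v) vcat \<Rightarrow> ('a \<Rightarrow> 'b, 'v) vcat" where
  "ihom A B = \<lparr>Obj = vfun A B, Hom = (\<lambda>f g. INF y\<in>Obj A. Hom B (f y) (g y))\<rparr>"

definition discrete :: "'a set \<Rightarrow> ('a, 'v::commutative_quantale) vcat" where
  "discrete X = \<lparr>Obj = X, Hom = (\<lambda>x' x. if x' = x then 1 else bot)\<rparr>"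

definition unit_vcat :: "'a \<Rightarrow> ('a, 'v::commutative_quantale) vcat" where
  "unit_vcat z = \<lparr>Obj = {z}, Hom = (\<lambda>_ _. 1)\<rparr>"


section \<open>Categories enriched in \<open>\<V>\<close>-cat\<close>

text \<open>
  \<open>Comp C x y z g f\<close> is the composite of \<open>f : x \<rightarrow> y\<close> and \<open>g : y \<rightarrow> z\<close>.  The record only carries
  the data; the notions below are applied to the concrete instances defined further down.
\<close>

record ('o, 'm, 'v) ecat =
  Ob :: "'o set"
  HomV :: "'o \<Rightarrow> 'o \<Rightarrow> ('m, 'v) vcat"
  Comp :: "'o \<Rightarrow> 'o \<Rightarrow> 'o \<Rightarrow> 'm \<Rightarrow> 'm \<Rightarrow> 'm"
  Idn :: "'o \<Rightarrow> 'm"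

definition ecat_op :: "('o, 'm, 'v) ecat \<Rightarrow> ('o, 'm, 'v) ecat" where
  "ecat_op K = \<lparr>Ob = Ob K, HomV = (\<lambda>x y. HomV K y x),
     Comp = (\<lambda>x y z g f. Comp K z y x f g), Idn = Idn K\<rparr>"

record ('o, 'm, 'p, 'n) efun =
  fobj :: "'o \<Rightarrow> 'p"
  fmap :: "'o \<Rightarrow> 'o \<Rightarrow> 'm \<Rightarrow> 'n"

definition efunctor ::
    "('o, 'm, 'v::commutative_quantale) ecat \<Rightarrow> ('p, 'n, 'v) ecat \<Rightarrow> ('o, 'm, 'p, 'n) efun \<Rightarrow> bool"
  where
  "efunctor K C F \<longleftrightarrow>
     (\<forall>x\<in>Ob K. fobj F x \<in> Ob C) \<and>
     (\<forall>x\<in>Ob K. \<forall>y\<in>Ob K. fmap F x y \<in> vfun (HomV K x y) (HomV C (fobj F x) (fobj F y))) \<and>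
     (\<forall>x\<in>Ob K. fmap F x x (Idn K x) = Idn C (fobj F x)) \<and>
     (\<forall>x\<in>Ob K. \<forall>y\<in>Ob K. \<forall>z\<in>Ob K. \<forall>f\<in>Obj (HomV K x y). \<forall>g\<in>Obj (HomV K y z).
        fmap F x z (Comp K x y z g f) =
        Comp C (fobj F x) (fobj F y) (fobj F z) (fmap F y z g) (fmap F x y f))"

definition efun_comp ::
    "('o, 'm, 'v) ecat \<Rightarrow> ('p, 'n, 'q, 'k) efun \<Rightarrow> ('o, 'm, 'p, 'n) efun \<Rightarrow> ('o, 'm, 'q, 'k) efun"
  where
  "efun_comp K G F = \<lparr>fobj = (\<lambda>x. fobj G (fobj F x)),
     fmap = (\<lambda>x y. \<lambda>f\<in>Obj (HomV K x y). fmap G (fobj F x) (fobj F y) (fmap F x y f))\<rparr>"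

definition efun_const :: "('o, 'm, 'v) ecat \<Rightarrow> ('p, 'n, 'v) ecat \<Rightarrow> 'p \<Rightarrow> ('o, 'm, 'p, 'n) efun" where
  "efun_const K C c = \<lparr>fobj = (\<lambda>_. c), fmap = (\<lambda>x y. \<lambda>f\<in>Obj (HomV K x y). Idn C c)\<rparr>"

text \<open>
  The hom \<open>[K,C](F,G)\<close> of the enriched functor category.  Since \<open>\<V>\<close>-functors are determined by
  their values on objects, enriched naturality is naturality with respect to every object of
  every hom of \<open>K\<close>; the distances are those of the end \<open>\<integral>\<^sub>x C(F x, G x)\<close>.
\<close>

definition nat_trans ::
    "('o, 'm, 'v::commutative_quantale) ecat \<Rightarrow> ('p, 'n, 'v) ecat \<Rightarrow>
     ('o, 'm, 'p, 'n) efun \<Rightarrow> ('o, 'm, 'p, 'n) efun \<Rightarrow> ('o \<Rightarrow> 'n, 'v) vcat" where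
  "nat_trans K C F G = \<lparr>
     Obj = {\<alpha> \<in> (\<Pi>\<^sub>E x\<in>Ob K. Obj (HomV C (fobj F x) (fobj G x))).
       \<forall>x\<in>Ob K. \<forall>y\<in>Ob K. \<forall>f\<in>Obj (HomV K x y).
         Comp C (fobj F x) (fobj G x) (fobj G y) (fmap G x y f) (\<alpha> x) =
         Comp C (fobj F x) (fobj F y) (fobj G y) (\<alpha> y) (fmap F x y f)},
     Hom = (\<lambda>\<alpha> \<beta>. INF x\<in>Ob K. Hom (HomV C (fobj F x) (fobj G x)) (\<alpha> x) (\<beta> x))\<rparr>"

text \<open>
  \<open>VCat \<U>\<close> is \<open>\<V>\<close>-cat restricted to \<open>\<V>\<close>-categories whose set of objects lies in \<open>\<U>\<close>.
  With \<open>\<U> = UNIV\<close> it is the target of weights, whose values are homs, with sets of maps as objects.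
\<close>

definition VCat ::
    "'a set set \<Rightarrow> (('a, 'v::commutative_quantale) vcat, 'a \<Rightarrow> 'a, 'v) ecat" where
  "VCat \<U> = \<lparr>Ob = {A. vcategory A \<and> Obj A \<in> \<U>}, HomV = ihom,
     Comp = (\<lambda>A B C g f. compose (Obj A) g f), Idn = (\<lambda>A. \<lambda>x\<in>Obj A. x)\<rparr>"

text \<open>The representable presheaf composed with \<open>F : K \<rightarrow> C\<close>, i.e. \<open>C(F-, z) : K\<^sup>o\<^sup>p \<rightarrow> \<V>-cat\<close>.\<close>

definition hom_into ::
    "('o, 'm, 'v) ecat \<Rightarrow> ('p, 'n, 'v) ecat \<Rightarrow> ('o, 'm, 'p, 'n) efun \<Rightarrow> 'p \<Rightarrow>
     ('o, 'm, ('n, 'v) vcat, 'n \<Rightarrow> 'n) efun" where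
  "hom_into K C F z = \<lparr>fobj = (\<lambda>x. HomV C (fobj F x) z),
     fmap = (\<lambda>y x. \<lambda>f\<in>Obj (HomV K x y). \<lambda>g\<in>Obj (HomV C (fobj F y) z).
       Comp C (fobj F x) (fobj F y) z g (fmap F x y f))\<rparr>"

text \<open>
  \<open>\<kappa> : W \<rightarrow> C(F-, c)\<close> exhibits \<open>c\<close> as the weighted colimit \<open>W * F\<close>: composition with it is an
  isomorphism \<open>C(c, z) \<cong> [K\<^sup>o\<^sup>p, \<V>-cat](W, C(F-, z))\<close> of \<open>\<V>\<close>-categories for every \<open>z\<close>.
\<close>

definition weighted_colimit ::
    "('o, 'm, 'v::commutative_quantale) ecat \<Rightarrow> ('p, 'n, 'v) ecat \<Rightarrow>
     ('o, 'm, ('n, 'v) vcat, 'n \<Rightarrow> 'n) efun \<Rightarrow> ('o, 'm, 'p, 'n) efun \<Rightarrow>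
     'p \<Rightarrow> ('o \<Rightarrow> 'n \<Rightarrow> 'n) \<Rightarrow> bool" where
  "weighted_colimit K C W F c \<kappa> \<longleftrightarrow>
     c \<in> Ob C \<and>
     \<kappa> \<in> Obj (nat_trans (ecat_op K) (VCat UNIV) W (hom_into K C F c)) \<and>
     (\<forall>z\<in>Ob C. vcat_iso (HomV C c z) (nat_trans (ecat_op K) (VCat UNIV) W (hom_into K C F z))
        (\<lambda>g\<in>Obj (HomV C c z). \<lambda>x\<in>Ob K. \<lambda>w\<in>Obj (fobj W x). Comp C (fobj F x) c z g (\<kappa> x w)))"

text \<open>
  \<open>\<eta> : H \<rightarrow> L D\<close> exhibits \<open>L : C \<rightarrow> E\<close> as the (pointwise) enriched left Kan extension of
  \<open>H : K \<rightarrow> E\<close> along \<open>D : K \<rightarrow> C\<close>: for every \<open>X\<close>, the transformation \<open>C(D-, X) \<rightarrow> E(H-, L X)\<close>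
  with \<open>h \<mapsto> L h \<circ> \<eta>\<close> exhibits \<open>L X\<close> as \<open>C(D-, X) * H\<close>.
\<close>

definition left_kan_extension ::
    "('o, 'm, 'v::commutative_quantale) ecat \<Rightarrow> ('p, 'n, 'v) ecat \<Rightarrow> ('q, 'n, 'v) ecat \<Rightarrow>
     ('o, 'm, 'p, 'n) efun \<Rightarrow> ('o, 'm, 'q, 'n) efun \<Rightarrow>
     ('p, 'n, 'q, 'n) efun \<Rightarrow> ('o \<Rightarrow> 'n) \<Rightarrow> bool" where
  "left_kan_extension K C E D H L \<eta> \<longleftrightarrow>
     efunctor C E L \<and>
     \<eta> \<in> Obj (nat_trans K E H (efun_comp K L D)) \<and>
     (\<forall>X\<in>Ob C. weighted_colimit K E (hom_into K C D X) H (fobj L X)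
        (\<lambda>x\<in>Ob K. \<lambda>h\<in>Obj (HomV C (fobj D x) X).
           Comp E (fobj H x) (fobj L (fobj D x)) (fobj L X) (fmap L (fobj D x) X h) (\<eta> x)))"


section \<open>Sets\<close>

text \<open>
  HOL has no type of all sets, so the category of small sets is taken relative to a
  collection \<open>\<U>\<close> of subsets of a type: the objects of \<open>Set\<close> are the members of \<open>\<U>\<close>, its morphisms
  are all functions between them, and small \<open>\<V>\<close>-categories have their sets of objects in \<open>\<U>\<close>.
  Only the closure properties needed to form the empty set, the object set of the unit
  \<open>\<V>\<close>-category, and relations \<open>R \<subseteq> X \<times> X\<close> are required; in particular, small sets in
  any model of ZFC qualify.
\<close>

locale set_universe =
  fixes \<U> :: "'u set set"
    and pt :: 'u
    and pair :: "'u \<Rightarrow> 'u \<Rightarrow> 'u"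
    and p0 p1 :: "'u \<Rightarrow> 'u"
  assumes empty_in: "{} \<in> \<U>"
    and point_in: "{pt} \<in> \<U>"
    and subset_in: "X \<in> \<U> \<Longrightarrow> Y \<subseteq> X \<Longrightarrow> Y \<in> \<U>"
    and times_in: "X \<in> \<U> \<Longrightarrow> Y \<in> \<U> \<Longrightarrow> {pair x y | x y. x \<in> X \<and> y \<in> Y} \<in> \<U>"
    and p0_pair: "p0 (pair x y) = x"
    and p1_pair: "p1 (pair x y) = y"

definition SetE :: "'u set set \<Rightarrow> ('u set, 'u \<Rightarrow> 'u, 'v::commutative_quantale) ecat" where
  "SetE \<U> = \<lparr>Ob = \<U>, HomV = (\<lambda>X Y. discrete (X \<rightarrow>\<^sub>E Y)),
     Comp = (\<lambda>X Y Z g f. compose X g f), Idn = (\<lambda>X. \<lambda>x\<in>X. x)\<rparr>"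

text \<open>The discrete functor \<open>D : Set \<rightarrow> \<V>-cat\<close>.\<close>

definition Disc ::
    "('u set, 'u \<Rightarrow> 'u, ('u, 'v::commutative_quantale) vcat, 'u \<Rightarrow> 'u) efun" where
  "Disc = \<lparr>fobj = discrete, fmap = (\<lambda>X Y. \<lambda>f\<in>X \<rightarrow>\<^sub>E Y. f)\<rparr>"

definition is_Lan ::
    "'u set set \<Rightarrow> ('u set, 'u \<Rightarrow> 'u, ('u, 'v::commutative_quantale) vcat, 'u \<Rightarrow> 'u) efun \<Rightarrow>
     (('u, 'v) vcat, 'u \<Rightarrow> 'u, ('u, 'v) vcat, 'u \<Rightarrow> 'u) efun \<Rightarrow> ('u set \<Rightarrow> 'u \<Rightarrow> 'u) \<Rightarrow> bool" where
  "is_Lan \<U> H L \<eta> \<longleftrightarrow> left_kan_extension (SetE \<U>) (VCat \<U>) (VCat \<U>) Disc H L \<eta>"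

text \<open>\<open>constants \<U> pt H\<close> is the \<open>\<V>\<close>-category of constants \<open>\<one> \<rightarrow> H\<close>.\<close>

definition constants ::
    "'u set set \<Rightarrow> 'u \<Rightarrow>
     ('u set, 'u \<Rightarrow> 'u, ('u, 'v::commutative_quantale) vcat, 'u \<Rightarrow> 'u) efun \<Rightarrow>
     ('u set \<Rightarrow> 'u \<Rightarrow> 'u, 'v) vcat" where
  "constants \<U> pt H =
     nat_trans (SetE \<U>) (VCat \<U>) (efun_const (SetE \<U>) (VCat \<U>) (unit_vcat pt)) H"

text \<open>\<open>nerve pair A r\<close> is the set \<open>A\<^sub>r\<close> of pairs at level \<open>r\<close>.\<close>

definition nerve ::
    "('u \<Rightarrow> 'u \<Rightarrow> 'u) \<Rightarrow> ('u, 'v::commutative_quantale) vcat \<Rightarrow> 'v \<Rightarrow> 'u set" where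
  "nerve pair A r = {pair x' x | x' x. x' \<in> Obj A \<and> x \<in> Obj A \<and> r \<le> Hom A x' x}"

definition preserves_nerves_of_sets ::
    "'u set set \<Rightarrow> ('u \<Rightarrow> 'u \<Rightarrow> 'u) \<Rightarrow> ('u \<Rightarrow> 'u) \<Rightarrow> ('u \<Rightarrow> 'u) \<Rightarrow>
     ('u set, 'u \<Rightarrow> 'u, ('u, 'v::commutative_quantale) vcat, 'u \<Rightarrow> 'u) efun \<Rightarrow> bool" where
  "preserves_nerves_of_sets \<U> pair p0 p1 H \<longleftrightarrow>
     (\<forall>X\<in>\<U>. \<forall>r::'v.
        let N = nerve pair (discrete X) r; d0 = restrict p0 N; d1 = restrict p1 N in
        r \<le> (INF C\<in>Obj (fobj H N). Hom (fobj H X) (fmap H N X d0 C) (fmap H N X d1 C)))"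

end

theory Submission
  imports Defs
begin

text \<open>
  The Kan extension at \<open>A\<close> is \<open>H\<close> of the set of objects of \<open>A\<close>, with the least larger distances
  that satisfy \<open>r \<le> d (H d\<^sub>0 C) (H d\<^sub>1 C)\<close> for every \<open>C\<close> in \<open>H (A\<^sub>r)\<close>: by Yoneda, a cocone from
  \<open>[D-, A]\<close> to \<open>[H-, Z]\<close> is a \<open>\<V>\<close>-functor from \<open>H (Obj A)\<close> to \<open>Z\<close>, and the enrichment of its
  components amounts to these inequalities, since two maps from \<open>Y\<close> to \<open>A\<close> at distance at least \<open>r\<close>
  factor through \<open>A\<^sub>r\<close>.
  For discrete \<open>A\<close> the inequalities can only fail because the empty infimum makes the self-distance
  of the unique map from \<open>\<emptyset>\<close> to \<open>A\<close> equal to \<open>\<top>\<close>, so that images of elements of \<open>H \<emptyset>\<close> must have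
  self-distance \<open>\<top>\<close>.
\<close>

section \<open>\<open>\<V>\<close>-categories and \<open>\<V>\<close>-functors\<close>

lemma quantale_mult_mono:
  fixes a b c d :: "'v::commutative_quantale"
  assumes "a \<le> b" "c \<le> d"
  shows "a * c \<le> b * d"
proof -
  have "a * c \<le> b * c"
    using assms(1) order_trans residuated by blast
  also have "\<dots> \<le> b * d"
    using assms(2) order_trans residuated by (metis mult.commute order_refl)
  finally show ?thesis .
qed

lemma vcategory_refl: "vcategory A \<Longrightarrow> x \<in> Obj A \<Longrightarrow> 1 \<le> Hom A x x"
  by (simp add: vcategory_def)

lemma vfunI:
  assumes "f \<in> Obj A \<rightarrow>\<^sub>E Obj B"
    and "\<And>x y. x \<in> Obj A \<Longrightarrow> y \<in> Obj A \<Longrightarrow> Hom A x y \<le> Hom B (f x) (f y)"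
  shows "f \<in> vfun A B"
  using assms by (simp add: vfun_def)

lemma vfun_PiE: "f \<in> vfun A B \<Longrightarrow> f \<in> Obj A \<rightarrow>\<^sub>E Obj B"
  by (simp add: vfun_def)

lemma vfun_Obj: "f \<in> vfun A B \<Longrightarrow> x \<in> Obj A \<Longrightarrow> f x \<in> Obj B"
  by (auto simp: vfun_def)

lemma vfun_Hom:
  "f \<in> vfun A B \<Longrightarrow> x \<in> Obj A \<Longrightarrow> y \<in> Obj A \<Longrightarrow> Hom A x y \<le> Hom B (f x) (f y)"
  by (simp add: vfun_def)

lemma vfun_eqI:
  assumes "f \<in> vfun A B" "g \<in> vfun A B" "\<And>x. x \<in> Obj A \<Longrightarrow> f x = g x"
  shows "f = g"
  using assms by (meson PiE_ext vfun_PiE)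

lemma vfun_id: "(\<lambda>x\<in>Obj A. x) \<in> vfun A A"
  by (rule vfunI) auto

lemma vfun_compose:
  assumes "f \<in> vfun A B" "g \<in> vfun B C"
  shows "compose (Obj A) g f \<in> vfun A C"
proof (rule vfunI)
  show "compose (Obj A) g f \<in> Obj A \<rightarrow>\<^sub>E Obj C"
    using assms by (auto simp: compose_def vfun_Obj)
  fix x y assume "x \<in> Obj A" "y \<in> Obj A"
  then show "Hom A x y \<le> Hom C (compose (Obj A) g f x) (compose (Obj A) g f y)"
    using assms by (simp add: compose_eq) (meson order_trans vfun_Hom vfun_Obj)
qed

lemma compose_id_right: "f \<in> A \<rightarrow>\<^sub>E B \<Longrightarrow> compose A f (\<lambda>x\<in>A. x) = f"
  by (rule ext) (auto simp: compose_def PiE_def extensional_def)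

lemma compose_id_left: "f \<in> A \<rightarrow>\<^sub>E B \<Longrightarrow> compose A (\<lambda>x\<in>B. x) f = f"
  by (rule ext) (auto simp: compose_def PiE_def extensional_def)

lemma compose_PiE: "f \<in> A \<rightarrow>\<^sub>E B \<Longrightarrow> g \<in> B \<rightarrow>\<^sub>E C \<Longrightarrow> compose A g f \<in> A \<rightarrow>\<^sub>E C"
  by (auto simp: compose_def)

lemma Obj_discrete [simp]: "Obj (discrete X) = X"
  by (simp add: discrete_def)

lemma Hom_discrete: "Hom (discrete X) x y = (if x = y then 1 else bot)"
  by (simp add: discrete_def)

lemma vcategory_discrete: "vcategory (discrete X :: ('a, 'v::commutative_quantale) vcat)"
proof -
  \<comment> \<open>Multiplication by \<open>a\<close> is a left adjoint, so it preserves the least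
    element; triangle inequalities with an off-diagonal factor become trivial.\<close>
  have "bot * a = (bot::'v)" for a :: 'v
    using residuated[of bot a bot] by (simp add: bot_unique)
  moreover from this have "a * bot = (bot::'v)" for a :: 'v
    by (metis mult.commute)
  ultimately show ?thesis
    by (auto simp: vcategory_def Hom_discrete)
qed

text \<open>Off-diagonal distances are \<open>bot\<close>, and a diagonal one only asks for
  \<open>1\<close> below a self-distance. Hence the objects of \<open>[D X, A]\<close> are plain
  functions, which makes the Yoneda argument available.\<close>

lemma vfun_discrete: "vcategory A \<Longrightarrow> vfun (discrete X) A = X \<rightarrow>\<^sub>E Obj A"
  by (auto simp: vfun_def Hom_discrete intro!: vcategory_refl)

lemma Obj_ihom [simp]: "Obj (ihom A B) = vfun A B"
  by (simp add: ihom_def)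

lemma Hom_ihom [simp]: "Hom (ihom A B) f g = (INF y\<in>Obj A. Hom B (f y) (g y))"
  by (simp add: ihom_def)

lemma fobj_Disc: "fobj Disc = discrete"
  by (simp add: Disc_def)

lemmas VCat_simps =
  VCat_def[THEN arg_cong[where f = Ob], simplified]
  VCat_def[THEN arg_cong[where f = HomV], simplified]
  VCat_def[THEN arg_cong[where f = Comp], simplified]
  VCat_def[THEN arg_cong[where f = Idn], simplified]

lemmas SetE_simps =
  SetE_def[THEN arg_cong[where f = Ob], simplified]
  SetE_def[THEN arg_cong[where f = HomV], simplified]
  SetE_def[THEN arg_cong[where f = Comp], simplified]
  SetE_def[THEN arg_cong[where f = Idn], simplified]


section \<open>Cocones under a functor on sets\<close>

locale set_vcat_functor = set_universe \<U> pt pair p0 p1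
  for \<U> :: "'u set set" and pt :: 'u and pair :: "'u \<Rightarrow> 'u \<Rightarrow> 'u" and p0 p1 :: "'u \<Rightarrow> 'u" +
  fixes H :: "('u set, 'u \<Rightarrow> 'u, ('u, 'v::commutative_quantale) vcat, 'u \<Rightarrow> 'u) efun"
  assumes H_efunctor: "efunctor (SetE \<U>) (VCat \<U>) H"
begin

abbreviation "weight A \<equiv> hom_into (SetE \<U>) (VCat \<U>) Disc A"

text \<open>Elementwise form of the natural transformations from \<open>weight A\<close> to
  \<open>[H-, Z]\<close>, as \<open>Obj_nat_trans_weight\<close> confirms.\<close>

definition cocones ::
    "('u, 'v) vcat \<Rightarrow> ('u, 'v) vcat \<Rightarrow> ('u set \<Rightarrow> ('u \<Rightarrow> 'u) \<Rightarrow> 'u \<Rightarrow> 'u) set" where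
  "cocones A Z = {\<alpha> \<in> (\<Pi>\<^sub>E Y\<in>\<U>. vfun (ihom (discrete Y) A) (ihom (fobj H Y) Z)).
     \<forall>X\<in>\<U>. \<forall>Y\<in>\<U>. \<forall>f\<in>Y \<rightarrow>\<^sub>E X. \<forall>h\<in>vfun (discrete X) A.
       compose (Obj (fobj H Y)) (\<alpha> X h) (fmap H Y X f) = \<alpha> Y (compose Y h f)}"

lemma H_vcategory: "X \<in> \<U> \<Longrightarrow> vcategory (fobj H X)"
  and H_Obj: "X \<in> \<U> \<Longrightarrow> Obj (fobj H X) \<in> \<U>"
  using H_efunctor by (auto simp: efunctor_def SetE_simps VCat_simps)

lemma H_map:
  assumes "X \<in> \<U>" "Y \<in> \<U>" "f \<in> X \<rightarrow>\<^sub>E Y"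
  shows "fmap H X Y f \<in> vfun (fobj H X) (fobj H Y)"
proof -
  have "fmap H X Y \<in> vfun (discrete (X \<rightarrow>\<^sub>E Y)) (ihom (fobj H X) (fobj H Y))"
    using H_efunctor assms(1,2) by (simp add: efunctor_def SetE_simps VCat_simps)
  from vfun_Obj[OF this] assms(3) show ?thesis by simp
qed

lemma H_id: "X \<in> \<U> \<Longrightarrow> fmap H X X (\<lambda>x\<in>X. x) = (\<lambda>x\<in>Obj (fobj H X). x)"
  using H_efunctor by (simp add: efunctor_def SetE_simps VCat_simps)

lemma H_compose:
  assumes "X \<in> \<U>" "Y \<in> \<U>" "Z \<in> \<U>" "f \<in> X \<rightarrow>\<^sub>E Y" "g \<in> Y \<rightarrow>\<^sub>E Z"
  shows "fmap H X Z (compose X g f) = compose (Obj (fobj H X)) (fmap H Y Z g) (fmap H X Y f)"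
  using H_efunctor assms by (simp add: efunctor_def SetE_simps VCat_simps)

lemma H_compose_apply:
  assumes "X \<in> \<U>" "Y \<in> \<U>" "Z \<in> \<U>" "f \<in> X \<rightarrow>\<^sub>E Y" "g \<in> Y \<rightarrow>\<^sub>E Z" "C \<in> Obj (fobj H X)"
  shows "fmap H X Z (compose X g f) C = fmap H Y Z g (fmap H X Y f C)"
  using assms by (simp add: H_compose compose_eq)

lemma H_map_Obj:
  assumes "X \<in> \<U>" "Y \<in> \<U>" "f \<in> X \<rightarrow>\<^sub>E Y" "C \<in> Obj (fobj H X)"
  shows "fmap H X Y f C \<in> Obj (fobj H Y)"
  using assms H_map vfun_Obj by metis

lemma fmap_hom_into_H:
  assumes "f \<in> Y \<rightarrow>\<^sub>E X"
  shows "fmap (hom_into (SetE \<U>) (VCat \<U>) H Z) X Y f =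
    (\<lambda>g\<in>vfun (fobj H X) Z. compose (Obj (fobj H Y)) g (fmap H Y X f))"
  using assms by (simp add: hom_into_def SetE_simps VCat_simps)

lemma fmap_weight:
  assumes "f \<in> Y \<rightarrow>\<^sub>E X"
  shows "fmap (weight A) X Y f = (\<lambda>g\<in>vfun (discrete X) A. compose Y g f)"
  using assms by (simp add: hom_into_def SetE_simps VCat_simps Disc_def)

lemma fobj_hom_into_H: "fobj (hom_into (SetE \<U>) (VCat \<U>) H Z) Y = ihom (fobj H Y) Z"
  by (simp add: hom_into_def SetE_simps VCat_simps)

lemma fobj_weight: "fobj (weight A) Y = ihom (discrete Y) A"
  by (simp add: hom_into_def SetE_simps VCat_simps Disc_def)

lemma vfun_discrete_compose:
  assumes "h \<in> vfun (discrete X) A" "f \<in> Y \<rightarrow>\<^sub>E X"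
  shows "compose Y h f \<in> vfun (discrete Y) A"
proof (rule vfunI)
  show "compose Y h f \<in> Obj (discrete Y) \<rightarrow>\<^sub>E Obj A"
    using assms by (auto simp: compose_def vfun_def)
  fix x y assume "x \<in> Obj (discrete Y)" "y \<in> Obj (discrete Y)"
  then show "Hom (discrete Y) x y \<le> Hom A (compose Y h f x) (compose Y h f y)"
    using PiE_mem[OF assms(2), of x] vfun_Hom[OF assms(1), of "f x" "f y"]
    by (auto simp: Hom_discrete compose_eq)
qed

lemma cocones_vfun:
  "\<alpha> \<in> cocones A Z \<Longrightarrow> Y \<in> \<U> \<Longrightarrow> \<alpha> Y \<in> vfun (ihom (discrete Y) A) (ihom (fobj H Y) Z)"
  by (auto simp: cocones_def)

lemma cocones_Obj:
  assumes "\<alpha> \<in> cocones A Z" "Y \<in> \<U>" "h \<in> vfun (discrete Y) A"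
  shows "\<alpha> Y h \<in> vfun (fobj H Y) Z"
  using vfun_Obj[OF cocones_vfun[OF assms(1,2)]] assms(3) by simp

lemma cocones_natural:
  assumes "\<alpha> \<in> cocones A Z" "X \<in> \<U>" "Y \<in> \<U>" "f \<in> Y \<rightarrow>\<^sub>E X" "h \<in> vfun (discrete X) A"
  shows "\<alpha> Y (compose Y h f) = compose (Obj (fobj H Y)) (\<alpha> X h) (fmap H Y X f)"
  using assms by (simp add: cocones_def)

lemma cocones_eqI:
  assumes "\<alpha> \<in> cocones A Z" "\<beta> \<in> cocones A Z"
    and "\<And>Y h. Y \<in> \<U> \<Longrightarrow> h \<in> vfun (discrete Y) A \<Longrightarrow> \<alpha> Y h = \<beta> Y h"
  shows "\<alpha> = \<beta>"
proof
  fix Y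
  show "\<alpha> Y = \<beta> Y"
  proof (cases "Y \<in> \<U>")
    case True
    then show ?thesis
      using vfun_eqI[OF cocones_vfun[OF assms(1)] cocones_vfun[OF assms(2)]] assms(3) by simp
  next
    case False
    then show ?thesis
      using assms(1,2) by (simp add: cocones_def PiE_def extensional_def)
  qed
qed

text \<open>Both sides of a naturality square are extensional maps on
  \<open>vfun (discrete X) A\<close>, so their equality can be tested at each
  \<open>h\<close>.\<close>

lemma Obj_nat_trans_weight:
  "Obj (nat_trans (ecat_op (SetE \<U>)) (VCat UNIV) (weight A) (hom_into (SetE \<U>) (VCat \<U>) H Z))
    = cocones A Z"
proof -
  have "(compose (vfun (discrete X) A) (fmap (hom_into (SetE \<U>) (VCat \<U>) H Z) X Y f) (\<alpha> X) =
      compose (vfun (discrete X) A) (\<alpha> Y) (fmap (weight A) X Y f)) \<longleftrightarrow>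
    (\<forall>h\<in>vfun (discrete X) A.
       compose (Obj (fobj H Y)) (\<alpha> X h) (fmap H Y X f) = \<alpha> Y (compose Y h f))"
    if "\<alpha> \<in> (\<Pi>\<^sub>E Y\<in>\<U>. vfun (ihom (discrete Y) A) (ihom (fobj H Y) Z))" "X \<in> \<U>"
      "f \<in> Y \<rightarrow>\<^sub>E X" for \<alpha> X Y f
    using vfun_Obj[OF PiE_mem[OF that(1,2)]] that(3)
    by (auto simp: compose_def fmap_hom_into_H fmap_weight fun_eq_iff restrict_def)
  then show ?thesis
    by (simp add: nat_trans_def cocones_def ecat_op_def SetE_simps VCat_simps
        fobj_hom_into_H fobj_weight cong: conj_cong)
qed

lemma Hom_nat_trans_weight:
  "Hom (nat_trans (ecat_op (SetE \<U>)) (VCat UNIV) (weight A) (hom_into (SetE \<U>) (VCat \<U>) H Z)) \<alpha> \<beta>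
    = (INF Y\<in>\<U>. INF h\<in>vfun (discrete Y) A. INF C\<in>Obj (fobj H Y). Hom Z (\<alpha> Y h C) (\<beta> Y h C))"
  by (simp add: nat_trans_def ecat_op_def SetE_simps VCat_simps fobj_hom_into_H fobj_weight)

text \<open>The comparison map from \<open>[c, Z]\<close> to the cocones with vertex
  \<open>Z\<close>: by \<open>weighted_colimit_weight_iff\<close>, a colimit cocone is one for which
  this is an isomorphism for every small \<open>Z\<close>.\<close>

definition whisker ::
    "('u, 'v) vcat \<Rightarrow> ('u set \<Rightarrow> ('u \<Rightarrow> 'u) \<Rightarrow> 'u \<Rightarrow> 'u) \<Rightarrow> ('u \<Rightarrow> 'u) \<Rightarrow>
     'u set \<Rightarrow> ('u \<Rightarrow> 'u) \<Rightarrow> 'u \<Rightarrow> 'u" where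
  "whisker A \<kappa> g = (\<lambda>Y\<in>\<U>. \<lambda>h\<in>vfun (discrete Y) A. compose (Obj (fobj H Y)) g (\<kappa> Y h))"

lemma weighted_colimit_weight_iff:
  "weighted_colimit (SetE \<U>) (VCat \<U>) (weight A) H c \<kappa> \<longleftrightarrow>
    vcategory c \<and> Obj c \<in> \<U> \<and> \<kappa> \<in> cocones A c \<and>
    (\<forall>Z. vcategory Z \<and> Obj Z \<in> \<U> \<longrightarrow>
      vcat_iso (ihom c Z)
        (nat_trans (ecat_op (SetE \<U>)) (VCat UNIV) (weight A) (hom_into (SetE \<U>) (VCat \<U>) H Z))
        (\<lambda>g\<in>vfun c Z. whisker A \<kappa> g))"
  by (simp add: weighted_colimit_def Obj_nat_trans_weight whisker_def SetE_simps VCat_simps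
      fobj_weight cong: restrict_cong)

text \<open>The enrichment survives because \<open>g\<close> does not lower distances; naturality is
  associativity of composition.\<close>

lemma whisker_cocones:
  assumes \<kappa>: "\<kappa> \<in> cocones A c" and g: "g \<in> vfun c Z"
  shows "whisker A \<kappa> g \<in> cocones A Z"
proof -
  have "whisker A \<kappa> g Y \<in> vfun (ihom (discrete Y) A) (ihom (fobj H Y) Z)" if Y: "Y \<in> \<U>" for Y
  proof (rule vfunI)
    show "whisker A \<kappa> g Y \<in> Obj (ihom (discrete Y) A) \<rightarrow>\<^sub>E Obj (ihom (fobj H Y) Z)"
      using Y vfun_compose[OF cocones_Obj[OF \<kappa> Y] g] by (auto simp: whisker_def)
    fix h h' assume h: "h \<in> Obj (ihom (discrete Y) A)" "h' \<in> Obj (ihom (discrete Y) A)"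
    have "Hom (ihom (discrete Y) A) h h' \<le> Hom (ihom (fobj H Y) c) (\<kappa> Y h) (\<kappa> Y h')"
      using vfun_Hom[OF cocones_vfun[OF \<kappa> Y]] h by simp
    also have "\<dots> \<le> Hom (ihom (fobj H Y) Z) (whisker A \<kappa> g Y h) (whisker A \<kappa> g Y h')"
      using h Y cocones_Obj[OF \<kappa> Y]
      by (auto simp: whisker_def compose_eq intro!: INF_mono vfun_Hom[OF g] bexI vfun_Obj)
    finally show "Hom (ihom (discrete Y) A) h h' \<le>
        Hom (ihom (fobj H Y) Z) (whisker A \<kappa> g Y h) (whisker A \<kappa> g Y h')" .
  qed
  moreover have "compose (Obj (fobj H Y)) (whisker A \<kappa> g X h) (fmap H Y X f) =
      whisker A \<kappa> g Y (compose Y h f)"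
    if "X \<in> \<U>" "Y \<in> \<U>" "f \<in> Y \<rightarrow>\<^sub>E X" "h \<in> vfun (discrete X) A" for X Y f h
  proof -
    have "compose (Obj (fobj H Y)) (compose (Obj (fobj H X)) g (\<kappa> X h)) (fmap H Y X f) =
        compose (Obj (fobj H Y)) g (compose (Obj (fobj H Y)) (\<kappa> X h) (fmap H Y X f))"
      using H_map_Obj[OF that(2,1,3)] by (auto simp: compose_def)
    then show ?thesis
      using that cocones_natural[OF \<kappa> that] vfun_discrete_compose[OF that(4,3)]
      by (simp add: whisker_def)
  qed
  ultimately show ?thesis
    by (auto simp: cocones_def) (auto simp: whisker_def)
qed


section \<open>The Kan extension\<close>

text \<open>The distances that make the identity map a functor out of \<open>H (Obj A)\<close> and a
  cocone over the image under \<open>H\<close> of the nerve diagram of \<open>A\<close>.\<close>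

definition nerve_structures :: "('u, 'v) vcat \<Rightarrow> ('u \<Rightarrow> 'u \<Rightarrow> 'v) set" where
  "nerve_structures A = {d. vcategory \<lparr>Obj = Obj (fobj H (Obj A)), Hom = d\<rparr> \<and>
     (\<forall>x\<in>Obj (fobj H (Obj A)). \<forall>y\<in>Obj (fobj H (Obj A)). Hom (fobj H (Obj A)) x y \<le> d x y) \<and>
     (\<forall>r. \<forall>C\<in>Obj (fobj H (nerve pair A r)).
       r \<le> d (fmap H (nerve pair A r) (Obj A) (restrict p0 (nerve pair A r)) C)
             (fmap H (nerve pair A r) (Obj A) (restrict p1 (nerve pair A r)) C))}"

definition lan :: "('u, 'v) vcat \<Rightarrow> ('u, 'v) vcat" where
  "lan A = \<lparr>Obj = Obj (fobj H (Obj A)), Hom = (\<lambda>x y. INF d\<in>nerve_structures A. d x y)\<rparr>"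

lemma Obj_lan [simp]: "Obj (lan A) = Obj (fobj H (Obj A))"
  by (simp add: lan_def)

lemma nerve_in: "Obj A \<in> \<U> \<Longrightarrow> nerve pair A r \<in> \<U>"
  by (rule subset_in[OF times_in[of "Obj A" "Obj A"]]) (auto simp: nerve_def)

lemma nerve_projections:
  "restrict p0 (nerve pair A r) \<in> nerve pair A r \<rightarrow>\<^sub>E Obj A"
  "restrict p1 (nerve pair A r) \<in> nerve pair A r \<rightarrow>\<^sub>E Obj A"
  by (auto simp: nerve_def p0_pair p1_pair)

text \<open>Infima of distances inherit the triangle inequality because multiplication is monotone:
  it suffices to compare with each \<open>d\<close> separately.\<close>

lemma vcategory_lan:
  assumes "Obj A \<in> \<U>"
  shows "vcategory (lan A)"
proof -
  have "(INF d\<in>nerve_structures A. d y x) * (INF d\<in>nerve_structures A. d w y)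
      \<le> (INF d\<in>nerve_structures A. d w x)"
    if "x \<in> Obj (lan A)" "y \<in> Obj (lan A)" "w \<in> Obj (lan A)" for x y w
  proof (rule INF_greatest)
    fix d assume d: "d \<in> nerve_structures A"
    have "(INF d\<in>nerve_structures A. d y x) * (INF d\<in>nerve_structures A. d w y) \<le> d y x * d w y"
      by (intro quantale_mult_mono INF_lower d)
    also have "\<dots> \<le> d w x"
      using d that by (simp add: nerve_structures_def vcategory_def)
    finally show "(INF d\<in>nerve_structures A. d y x) * (INF d\<in>nerve_structures A. d w y) \<le> d w x" .
  qed
  then show ?thesis
    by (auto simp: vcategory_def lan_def nerve_structures_def intro!: INF_greatest)
qed

lemma Hom_le_lan:
  assumes "x \<in> Obj (fobj H (Obj A))" "y \<in> Obj (fobj H (Obj A))"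
  shows "Hom (fobj H (Obj A)) x y \<le> Hom (lan A) x y"
  using assms by (auto simp: lan_def nerve_structures_def intro!: INF_greatest)

lemma nerve_le_lan:
  assumes "C \<in> Obj (fobj H (nerve pair A r))"
  shows "r \<le> Hom (lan A) (fmap H (nerve pair A r) (Obj A) (restrict p0 (nerve pair A r)) C)
    (fmap H (nerve pair A r) (Obj A) (restrict p1 (nerve pair A r)) C)"
  using assms by (auto simp: lan_def nerve_structures_def intro!: INF_greatest)

text \<open>The distances of \<open>Z\<close> pulled back along \<open>g\<close> form one of the
  \<open>nerve_structures\<close>, so their infimum lies below them.\<close>

lemma vfun_lanI:
  assumes g: "g \<in> vfun (fobj H (Obj A)) Z" and Z: "vcategory Z" and A: "Obj A \<in> \<U>"
    and le: "\<And>r C. C \<in> Obj (fobj H (nerve pair A r)) \<Longrightarrow>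
      r \<le> Hom Z (g (fmap H (nerve pair A r) (Obj A) (restrict p0 (nerve pair A r)) C))
                (g (fmap H (nerve pair A r) (Obj A) (restrict p1 (nerve pair A r)) C))"
  shows "g \<in> vfun (lan A) Z"
proof (rule vfunI)
  show "g \<in> Obj (lan A) \<rightarrow>\<^sub>E Obj Z"
    using vfun_PiE[OF g] by simp
  fix x y assume "x \<in> Obj (lan A)" "y \<in> Obj (lan A)"
  have "(\<lambda>x y. Hom Z (g x) (g y)) \<in> nerve_structures A"
    using Z le by (auto simp: nerve_structures_def vcategory_def vfun_Obj[OF g] vfun_Hom[OF g])
  then show "Hom (lan A) x y \<le> Hom Z (g x) (g y)"
    by (auto simp: lan_def intro: INF_lower2)
qed

lemma vfun_lan_H:
  assumes "g \<in> vfun (lan A) Z"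
  shows "g \<in> vfun (fobj H (Obj A)) Z"
  using vfun_PiE[OF assms] vfun_Hom[OF assms]
  by (intro vfunI) (auto intro: order_trans[OF Hom_le_lan])

text \<open>The defining inequalities concern only the projections of the nerve. Factoring through
  the nerve transports them to every parallel pair, which is the enrichment required of the
  universal cocone.\<close>

lemma le_lan:
  assumes A: "Obj A \<in> \<U>" and Y: "Y \<in> \<U>" and f: "f \<in> Y \<rightarrow>\<^sub>E Obj A" "f' \<in> Y \<rightarrow>\<^sub>E Obj A"
    and C: "C \<in> Obj (fobj H Y)"
  shows "(INF y\<in>Y. Hom A (f y) (f' y)) \<le> Hom (lan A) (fmap H Y (Obj A) f C) (fmap H Y (Obj A) f' C)"
proof -
  \<comment> \<open>With \<open>r\<close> the infimum itself, every pair of values of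
    \<open>f\<close> and \<open>f'\<close> lies in the nerve at level \<open>r\<close>, so the
    pairing \<open>m\<close> lands there.\<close>
  define r where "r = (INF y\<in>Y. Hom A (f y) (f' y))"
  define N where "N = nerve pair A r"
  define m where "m = (\<lambda>y\<in>Y. pair (f y) (f' y))"
  have N: "N \<in> \<U>" using A by (simp add: N_def nerve_in)
  have mN: "pair (f y) (f' y) \<in> N" if "y \<in> Y" for y
    using that f by (auto simp: N_def nerve_def r_def intro!: INF_lower)
  then have m: "m \<in> Y \<rightarrow>\<^sub>E N"
    by (simp add: m_def)
  have "compose Y (restrict p0 N) m = f" "compose Y (restrict p1 N) m = f'"
    using mN f by (auto simp: compose_def m_def p0_pair p1_pair PiE_def extensional_def fun_eq_iff)
  then have "fmap H Y (Obj A) f C = fmap H N (Obj A) (restrict p0 N) (fmap H Y N m C)"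
    "fmap H Y (Obj A) f' C = fmap H N (Obj A) (restrict p1 N) (fmap H Y N m C)"
    using H_compose_apply[OF Y N A m _ C] nerve_projections[of A r]
    unfolding N_def by metis+
  then show ?thesis
    using nerve_le_lan[of "fmap H Y N m C" A r] H_map_Obj[OF Y N m C]
    by (simp add: N_def r_def)
qed

section \<open>The universal cocone and the colimit property\<close>

definition lan_cocone :: "('u, 'v) vcat \<Rightarrow> 'u set \<Rightarrow> ('u \<Rightarrow> 'u) \<Rightarrow> 'u \<Rightarrow> 'u" where
  "lan_cocone A = (\<lambda>Y\<in>\<U>. \<lambda>h\<in>vfun (discrete Y) A. fmap H Y (Obj A) h)"

text \<open>Naturality is functoriality of \<open>H\<close>; the enrichment of the components is
  \<open>le_lan\<close>.\<close>

lemma lan_cocone_cocones: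
  assumes A: "vcategory A" "Obj A \<in> \<U>"
  shows "lan_cocone A \<in> cocones A (lan A)"
proof -
  have *: "fmap H Y (Obj A) h \<in> vfun (fobj H Y) (lan A)" if "Y \<in> \<U>" "h \<in> Y \<rightarrow>\<^sub>E Obj A" for Y h
  proof (rule vfunI)
    have h: "fmap H Y (Obj A) h \<in> vfun (fobj H Y) (fobj H (Obj A))"
      by (rule H_map[OF that(1) A(2) that(2)])
    then show "fmap H Y (Obj A) h \<in> Obj (fobj H Y) \<rightarrow>\<^sub>E Obj (lan A)"
      by (simp add: vfun_PiE)
    fix x y assume "x \<in> Obj (fobj H Y)" "y \<in> Obj (fobj H Y)"
    then show "Hom (fobj H Y) x y \<le> Hom (lan A) (fmap H Y (Obj A) h x) (fmap H Y (Obj A) h y)"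
      using vfun_Hom[OF h] Hom_le_lan vfun_Obj[OF h] by (meson order_trans)
  qed
  have "lan_cocone A Y \<in> vfun (ihom (discrete Y) A) (ihom (fobj H Y) (lan A))" if Y: "Y \<in> \<U>" for Y
    using * Y A le_lan[OF A(2) Y]
    by (intro vfunI) (auto simp: lan_cocone_def vfun_discrete intro!: INF_greatest)
  then show ?thesis
    using A by (auto simp: cocones_def vfun_discrete compose_PiE H_compose lan_cocone_def)
qed

text \<open>Yoneda: a cocone is determined by its value at the identity of \<open>Obj A\<close>.\<close>

lemma cocones_eq_whisker:
  assumes A: "vcategory A" "Obj A \<in> \<U>" and \<alpha>: "\<alpha> \<in> cocones A Z"
  shows "\<alpha> = whisker A (lan_cocone A) (\<alpha> (Obj A) (\<lambda>x\<in>Obj A. x))"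
    and "vcategory Z \<Longrightarrow> \<alpha> (Obj A) (\<lambda>x\<in>Obj A. x) \<in> vfun (lan A) Z"
proof -
  let ?g = "\<alpha> (Obj A) (\<lambda>x\<in>Obj A. x)"
  have id: "(\<lambda>x\<in>Obj A. x) \<in> vfun (discrete (Obj A)) A"
    using A by (simp add: vfun_discrete)
  \<comment> \<open>Every \<open>h\<close> is the identity precomposed with \<open>h\<close>, so
    naturality computes the whole cocone from \<open>?g\<close>.\<close>
  have val: "\<alpha> Y h = compose (Obj (fobj H Y)) ?g (fmap H Y (Obj A) h)"
    if "Y \<in> \<U>" "h \<in> Y \<rightarrow>\<^sub>E Obj A" for Y h
    using cocones_natural[OF \<alpha> A(2) that id] that by (simp add: compose_id_left)
  show "\<alpha> = whisker A (lan_cocone A) ?g"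
  proof
    fix Y
    show "\<alpha> Y = whisker A (lan_cocone A) ?g Y"
    proof (cases "Y \<in> \<U>")
      case True
      have "\<alpha> Y \<in> extensional (vfun (discrete Y) A)"
        using vfun_PiE[OF cocones_vfun[OF \<alpha> True]] by (simp add: PiE_def)
      then show ?thesis
        using True A val
        by (auto simp: whisker_def lan_cocone_def vfun_discrete extensional_def fun_eq_iff)
    next
      case False
      then show ?thesis
        using \<alpha> by (simp add: whisker_def cocones_def PiE_def extensional_def)
    qed
  qed
  show "?g \<in> vfun (lan A) Z" if Z: "vcategory Z"
  proof (rule vfun_lanI[OF cocones_Obj[OF \<alpha> A(2) id] Z A(2)])
    fix r C
    let ?N = "nerve pair A r"
    let ?d0 = "restrict p0 ?N" and ?d1 = "restrict p1 ?N"
    assume C: "C \<in> Obj (fobj H ?N)"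
    have N: "?N \<in> \<U>" by (rule nerve_in[OF A(2)])
    \<comment> \<open>The projections of the nerve are at distance at least \<open>r\<close> by
      construction; the enrichment of \<open>\<alpha>\<close> carries this bound to
      \<open>Z\<close>.\<close>
    have "r \<le> Hom (ihom (discrete ?N) A) ?d0 ?d1"
      by (auto simp: nerve_def p0_pair p1_pair intro!: INF_greatest)
    also have "\<dots> \<le> Hom (ihom (fobj H ?N) Z) (\<alpha> ?N ?d0) (\<alpha> ?N ?d1)"
      using nerve_projections[of A r] A by (intro vfun_Hom[OF cocones_vfun[OF \<alpha> N]])
        (simp_all add: vfun_discrete)
    also have "\<dots> \<le> Hom Z (\<alpha> ?N ?d0 C) (\<alpha> ?N ?d1 C)"
      using C by (auto intro: INF_lower)
    finally show "r \<le> Hom Z (?g (fmap H ?N (Obj A) ?d0 C)) (?g (fmap H ?N (Obj A) ?d1 C))"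
      using C by (simp add: val[OF N nerve_projections(1)] val[OF N nerve_projections(2)] compose_eq)
  qed
qed

lemma whisker_lan_cocone_id:
  assumes A: "vcategory A" "Obj A \<in> \<U>" and g: "g \<in> vfun (lan A) Z"
  shows "whisker A (lan_cocone A) g (Obj A) (\<lambda>x\<in>Obj A. x) = g"
  using A vfun_PiE[OF g]
  by (simp add: whisker_def lan_cocone_def vfun_discrete H_id compose_id_right)

text \<open>The inverse of whiskering evaluates a cocone at the identity of
  \<open>Obj A\<close>.\<close>

lemma weighted_colimit_lan:
  assumes A: "vcategory A" "Obj A \<in> \<U>"
  shows "weighted_colimit (SetE \<U>) (VCat \<U>) (weight A) H (lan A) (lan_cocone A)"
proof -
  have "vcat_iso (ihom (lan A) Z)
        (nat_trans (ecat_op (SetE \<U>)) (VCat UNIV) (weight A) (hom_into (SetE \<U>) (VCat \<U>) H Z))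
        (\<lambda>g\<in>vfun (lan A) Z. whisker A (lan_cocone A) g)"
    if Z: "vcategory Z" "Obj Z \<in> \<U>" for Z
  proof -
    let ?N = "nat_trans (ecat_op (SetE \<U>)) (VCat UNIV) (weight A) (hom_into (SetE \<U>) (VCat \<U>) H Z)"
    let ?\<Phi> = "\<lambda>g\<in>vfun (lan A) Z. whisker A (lan_cocone A) g"
    let ?\<Psi> = "\<lambda>\<alpha>\<in>cocones A Z. \<alpha> (Obj A) (\<lambda>x\<in>Obj A. x)"
    note wc = whisker_cocones[OF lan_cocone_cocones[OF A]]
    \<comment> \<open>The distance of the whiskered cocones is an infimum over points
      \<open>H h C\<close>, all of which are objects of \<open>lan A\<close>.\<close>
    have "Hom (ihom (lan A) Z) g g' \<le>
        Hom ?N (whisker A (lan_cocone A) g) (whisker A (lan_cocone A) g')"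
      if g: "g \<in> vfun (lan A) Z" "g' \<in> vfun (lan A) Z" for g g'
      unfolding Hom_nat_trans_weight
      using A
      by (auto simp: whisker_def lan_cocone_def compose_eq vfun_discrete
          intro!: INF_greatest INF_lower H_map_Obj)
    then have "?\<Phi> \<in> vfun (ihom (lan A) Z) ?N"
      using wc by (intro vfunI) (auto simp: Obj_nat_trans_weight)
    moreover have "?\<Psi> \<in> vfun ?N (ihom (lan A) Z)"
    proof (rule vfunI)
      show "?\<Psi> \<in> Obj ?N \<rightarrow>\<^sub>E Obj (ihom (lan A) Z)"
        using cocones_eq_whisker(2)[OF A _ Z(1)] by (simp add: Obj_nat_trans_weight)
      fix \<alpha> \<beta> assume "\<alpha> \<in> Obj ?N" "\<beta> \<in> Obj ?N"
      moreover have "(\<lambda>x\<in>Obj A. x) \<in> vfun (discrete (Obj A)) A"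
        using A by (simp add: vfun_discrete)
      \<comment> \<open>The identity of \<open>Obj A\<close> is one of the indices of the infimum on
        the left.\<close>
      ultimately show "Hom ?N \<alpha> \<beta> \<le> Hom (ihom (lan A) Z) (?\<Psi> \<alpha>) (?\<Psi> \<beta>)"
        unfolding Hom_nat_trans_weight Obj_nat_trans_weight
        by (intro INF_lower2[OF A(2)] INF_lower2[of "\<lambda>x\<in>Obj A. x"]) simp_all
    qed
    moreover have "?\<Psi> (?\<Phi> g) = g" if "g \<in> vfun (lan A) Z" for g
      using that wc whisker_lan_cocone_id[OF A] by simp
    moreover have "?\<Phi> (?\<Psi> \<alpha>) = \<alpha>" if "\<alpha> \<in> cocones A Z" for \<alpha>
      using that cocones_eq_whisker[OF A that] Z by simp
    ultimately show ?thesis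
      unfolding vcat_iso_def Obj_nat_trans_weight Obj_ihom by blast
  qed
  then show ?thesis
    using A by (simp add: weighted_colimit_weight_iff vcategory_lan H_Obj lan_cocone_cocones)
qed

section \<open>Functoriality of the Kan extension and its unit\<close>

definition lan_functor ::
    "(('u, 'v) vcat, 'u \<Rightarrow> 'u, ('u, 'v) vcat, 'u \<Rightarrow> 'u) efun" where
  "lan_functor = \<lparr>fobj = lan, fmap = (\<lambda>A B. \<lambda>f\<in>vfun A B. fmap H (Obj A) (Obj B) f)\<rparr>"

text \<open>By \<open>vfun_lanI\<close> only the nerve of \<open>A\<close> matters. Composing its
  projections with \<open>f\<close> gives maps into \<open>B\<close> at distance at least
  \<open>r\<close>, to which \<open>le_lan\<close> for \<open>B\<close> applies.\<close>

lemma lan_map: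
  assumes A: "Obj A \<in> \<U>" and B: "Obj B \<in> \<U>" and f: "f \<in> vfun A B"
  shows "fmap H (Obj A) (Obj B) f \<in> vfun (lan A) (lan B)"
proof (rule vfun_lanI[OF _ vcategory_lan[OF B] A])
  have Hf: "fmap H (Obj A) (Obj B) f \<in> vfun (fobj H (Obj A)) (fobj H (Obj B))"
    by (rule H_map[OF A B vfun_PiE[OF f]])
  show "fmap H (Obj A) (Obj B) f \<in> vfun (fobj H (Obj A)) (lan B)"
    using vfun_PiE[OF Hf] vfun_Hom[OF Hf] vfun_Obj[OF Hf]
    by (intro vfunI) (auto intro: order_trans[OF _ Hom_le_lan])
  fix r C
  let ?N = "nerve pair A r"
  let ?d0 = "restrict p0 ?N" and ?d1 = "restrict p1 ?N"
  assume C: "C \<in> Obj (fobj H ?N)"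
  have N: "?N \<in> \<U>" by (rule nerve_in[OF A])
  note d = nerve_projections[of A r]
  have "r \<le> (INF y\<in>?N. Hom B (compose ?N f ?d0 y) (compose ?N f ?d1 y))"
    by (auto simp: compose_eq nerve_def p0_pair p1_pair
        intro!: INF_greatest intro: order_trans[OF _ vfun_Hom[OF f]])
  also have "\<dots> \<le> Hom (lan B) (fmap H ?N (Obj B) (compose ?N f ?d0) C)
      (fmap H ?N (Obj B) (compose ?N f ?d1) C)"
    by (rule le_lan[OF B N _ _ C]) (rule compose_PiE[OF _ vfun_PiE[OF f]], rule d)+
  finally show "r \<le> Hom (lan B)
      (fmap H (Obj A) (Obj B) f (fmap H ?N (Obj A) ?d0 C))
      (fmap H (Obj A) (Obj B) f (fmap H ?N (Obj A) ?d1 C))"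
    by (simp only: H_compose_apply[OF N A B d(1) vfun_PiE[OF f] C]
        H_compose_apply[OF N A B d(2) vfun_PiE[OF f] C])
qed

lemma efunctor_lan: "efunctor (VCat \<U>) (VCat \<U>) lan_functor"
proof -
  \<comment> \<open>The enrichment on homs is \<open>le_lan\<close> for \<open>B\<close> at the set
    \<open>Obj A\<close>.\<close>
  have "(\<lambda>f\<in>vfun A B. fmap H (Obj A) (Obj B) f) \<in> vfun (ihom A B) (ihom (lan A) (lan B))"
    if "Obj A \<in> \<U>" "Obj B \<in> \<U>" for A B
    using that lan_map
    by (intro vfunI) (auto intro!: INF_greatest le_lan vfun_PiE)
  then show ?thesis
    by (auto simp: efunctor_def VCat_simps lan_functor_def vcategory_lan H_Obj H_id
        vfun_id vfun_compose H_compose[OF _ _ _ vfun_PiE vfun_PiE])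
qed

lemma is_Lan_iff:
  "is_Lan \<U> H L \<eta> \<longleftrightarrow>
    efunctor (VCat \<U>) (VCat \<U>) L \<and>
    \<eta> \<in> (\<Pi>\<^sub>E X\<in>\<U>. vfun (fobj H X) (fobj L (discrete X))) \<and>
    (\<forall>X\<in>\<U>. \<forall>Y\<in>\<U>. \<forall>f\<in>X \<rightarrow>\<^sub>E Y.
      compose (Obj (fobj H X)) (fmap L (discrete X) (discrete Y) f) (\<eta> X) =
      compose (Obj (fobj H X)) (\<eta> Y) (fmap H X Y f)) \<and>
    (\<forall>A. vcategory A \<and> Obj A \<in> \<U> \<longrightarrow>
      weighted_colimit (SetE \<U>) (VCat \<U>) (weight A) H (fobj L A)
        (\<lambda>Y\<in>\<U>. \<lambda>h\<in>vfun (discrete Y) A.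
          compose (Obj (fobj H Y)) (fmap L (discrete Y) A h) (\<eta> Y)))"
proof -
  have "\<eta> \<in> Obj (nat_trans (SetE \<U>) (VCat \<U>) H
        (efun_comp (SetE \<U> :: (_, _, 'v) ecat) L Disc)) \<longleftrightarrow>
    \<eta> \<in> (\<Pi>\<^sub>E X\<in>\<U>. vfun (fobj H X) (fobj L (discrete X))) \<and>
    (\<forall>X\<in>\<U>. \<forall>Y\<in>\<U>. \<forall>f\<in>X \<rightarrow>\<^sub>E Y.
      compose (Obj (fobj H X)) (fmap L (discrete X) (discrete Y) f) (\<eta> X) =
      compose (Obj (fobj H X)) (\<eta> Y) (fmap H X Y f))"
    by (simp add: nat_trans_def efun_comp_def SetE_simps VCat_simps fobj_Disc)
      (simp add: Disc_def)
  then show ?thesis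
    unfolding is_Lan_def left_kan_extension_def
    by (simp add: SetE_simps VCat_simps fobj_Disc)
qed

text \<open>\<open>lan (discrete X)\<close> has the same objects as \<open>H X\<close> and larger
  distances, so the identity map serves as the unit.\<close>

lemma is_Lan_lan: "is_Lan \<U> H lan_functor (\<lambda>X\<in>\<U>. \<lambda>x\<in>Obj (fobj H X). x)"
proof -
  have "(\<lambda>x\<in>Obj (fobj H X). x) \<in> vfun (fobj H X) (lan (discrete X))" if "X \<in> \<U>" for X
    using vfun_lan_H[OF vfun_id, of "discrete X"] by simp
  moreover have "compose (Obj (fobj H X)) (fmap lan_functor (discrete X) (discrete Y) f)
        (\<lambda>x\<in>Obj (fobj H X). x) =
      compose (Obj (fobj H X)) (\<lambda>x\<in>Obj (fobj H Y). x) (fmap H X Y f)"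
    if "X \<in> \<U>" "Y \<in> \<U>" "f \<in> X \<rightarrow>\<^sub>E Y" for X Y f
    using that
    by (simp add: lan_functor_def vfun_discrete vcategory_discrete
        compose_id_left[OF vfun_PiE[OF H_map]] compose_id_right[OF vfun_PiE[OF H_map]])
  moreover have "(\<lambda>Y\<in>\<U>. \<lambda>h\<in>vfun (discrete Y) A. compose (Obj (fobj H Y))
      (fmap lan_functor (discrete Y) A h) ((\<lambda>X\<in>\<U>. \<lambda>x\<in>Obj (fobj H X). x) Y)) = lan_cocone A"
    if "vcategory A" "Obj A \<in> \<U>" for A
    using that
    by (auto simp: lan_cocone_def lan_functor_def vfun_discrete
        compose_id_right[OF vfun_PiE[OF H_map]] intro!: restrict_ext)
  moreover have "fobj lan_functor = lan"
    by (simp add: lan_functor_def)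
  ultimately show ?thesis
    by (simp add: is_Lan_iff efunctor_lan weighted_colimit_lan)
qed


section \<open>The equivalent conditions\<close>

text \<open>By extensionality, the unique map out of the empty set is \<open>undefined\<close>
  everywhere.\<close>

lemma empty_map: "X \<in> \<U> \<Longrightarrow> (\<lambda>_. undefined) \<in> {} \<rightarrow>\<^sub>E X"
  by simp

lemma empty_map_id: "(\<lambda>_. undefined) = (\<lambda>x\<in>{}. x)"
  by auto

text \<open>
  The infimum equals \<open>1\<close> or \<open>bot\<close> unless \<open>Y\<close> is empty, in which case it is \<open>top\<close>.
\<close>

lemma INF_discrete_le:
  assumes top: "\<forall>x\<in>Obj (fobj H {}). Hom (fobj H {}) x x = top"
    and "X \<in> \<U>" "Y \<in> \<U>" "f \<in> Y \<rightarrow>\<^sub>E X" "f' \<in> Y \<rightarrow>\<^sub>E X" "C \<in> Obj (fobj H Y)"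
  shows "(INF y\<in>Y. Hom (discrete X :: ('u, 'v) vcat) (f y) (f' y))
    \<le> Hom (fobj H X) (fmap H Y X f C) (fmap H Y X f' C)"
proof (cases "f = f'")
  case f: True
  show ?thesis
  proof (cases "Y = {}")
    case True
    \<comment> \<open>Here the infimum is \<open>top\<close>, and so is the self-distance of
      \<open>C\<close>, which \<open>H f\<close> cannot lower.\<close>
    have "Hom (fobj H Y) C C \<le> Hom (fobj H X) (fmap H Y X f C) (fmap H Y X f' C)"
      using vfun_Hom[OF H_map[OF assms(3,2,4)]] assms(6) f by simp
    then show ?thesis
      using True top assms(6) by (simp add: top_unique)
  next
    case False
    then show ?thesis
      using f assms by (simp add: Hom_discrete vcategory_refl H_vcategory H_map_Obj)
  qed
next
  case False
  \<comment> \<open>Distinct extensional maps differ at a point of \<open>Y\<close>, where the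
    discrete distance is \<open>bot\<close>.\<close>
  then obtain y where "y \<in> Y" "f y \<noteq> f' y"
    using assms by (meson PiE_ext)
  then have "(INF y\<in>Y. Hom (discrete X :: ('u, 'v) vcat) (f y) (f' y)) \<le> bot"
    by (intro INF_lower2[of y]) (simp_all add: Hom_discrete)
  then show ?thesis
    by (simp add: bot_unique)
qed

text \<open>By \<open>INF_discrete_le\<close> the original distances of \<open>H X\<close> already
  support the universal cocone. The map it induces out of the colimit will be the inverse of the
  unit.\<close>

lemma lan_cocone_discrete:
  assumes top: "\<forall>x\<in>Obj (fobj H {}). Hom (fobj H {}) x x = top" and X: "X \<in> \<U>"
  shows "lan_cocone (discrete X) \<in> cocones (discrete X) (fobj H X)"
proof -
  have "lan_cocone (discrete X) Y \<in> vfun (ihom (discrete Y) (discrete X)) (ihom (fobj H Y) (fobj H X))"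
    if Y: "Y \<in> \<U>" for Y
    using Y X INF_discrete_le[OF top X Y] H_map[OF Y X]
    by (intro vfunI)
      (auto simp: lan_cocone_def vfun_discrete vcategory_discrete intro!: INF_greatest)
  then show ?thesis
    using X
    by (auto simp: cocones_def lan_cocone_def vfun_discrete vcategory_discrete compose_PiE H_compose)
qed

section \<open>The unit of an arbitrary Kan extension\<close>

context
  fixes L :: "(('u, 'v) vcat, 'u \<Rightarrow> 'u, ('u, 'v) vcat, 'u \<Rightarrow> 'u) efun" and \<eta> :: "'u set \<Rightarrow> 'u \<Rightarrow> 'u"
  assumes Lan: "is_Lan \<U> H L \<eta>"
begin

definition unit_cocone :: "('u, 'v) vcat \<Rightarrow> 'u set \<Rightarrow> ('u \<Rightarrow> 'u) \<Rightarrow> 'u \<Rightarrow> 'u" where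
  "unit_cocone A = (\<lambda>Y\<in>\<U>. \<lambda>h\<in>vfun (discrete Y) A.
     compose (Obj (fobj H Y)) (fmap L (discrete Y) A h) (\<eta> Y))"

lemma unit_vfun: "X \<in> \<U> \<Longrightarrow> \<eta> X \<in> vfun (fobj H X) (fobj L (discrete X))"
  using Lan is_Lan_iff by (blast dest: PiE_mem)

lemma unit_cocone_colimit:
  "X \<in> \<U> \<Longrightarrow> weighted_colimit (SetE \<U>) (VCat \<U>) (weight (discrete X)) H (fobj L (discrete X))
    (unit_cocone (discrete X))"
  using Lan[THEN is_Lan_iff[THEN iffD1], THEN conjunct2, THEN conjunct2, THEN conjunct2,
      rule_format, of "discrete X"]
  by (simp only: vcategory_discrete Obj_discrete unit_cocone_def simp_thms)

lemma unit_cocone_cocones: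
  "X \<in> \<U> \<Longrightarrow> unit_cocone (discrete X) \<in> cocones (discrete X) (fobj L (discrete X))"
  using unit_cocone_colimit by (simp add: weighted_colimit_weight_iff)

text \<open>Maps between discrete categories are maps of sets, so naturality of
  \<open>\<eta>\<close> trades \<open>L h\<close> for \<open>H h\<close>.\<close>

lemma unit_cocone_apply:
  assumes "X \<in> \<U>" "Y \<in> \<U>" "h \<in> Y \<rightarrow>\<^sub>E X"
  shows "unit_cocone (discrete X) Y h = compose (Obj (fobj H Y)) (\<eta> X) (fmap H Y X h)"
proof -
  have "compose (Obj (fobj H Y)) (fmap L (discrete Y) (discrete X) h) (\<eta> Y) =
      compose (Obj (fobj H Y)) (\<eta> X) (fmap H Y X h)"
    using Lan[THEN is_Lan_iff[THEN iffD1]] assms by blast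
  then show ?thesis
    using assms by (simp add: unit_cocone_def vfun_discrete vcategory_discrete)
qed

lemma unit_cocone_id:
  assumes "X \<in> \<U>"
  shows "unit_cocone (discrete X) X (\<lambda>x\<in>X. x) = \<eta> X"
  using assms vfun_PiE[OF unit_vfun[OF assms]]
  by (simp add: unit_cocone_apply H_id compose_id_right)

text \<open>The identity of the empty category has self-distance \<open>top\<close>, an empty
  infimum. The colimit cocone sends it to \<open>\<eta> {}\<close>, and the inverse of the unit
  brings the bound back to \<open>H {}\<close>.\<close>

lemma empty_self_distance_top_if_unit_iso:
  assumes iso: "vcat_iso (fobj H {}) (fobj L (discrete {})) (\<eta> {})" and x: "x \<in> Obj (fobj H {})"
  shows "Hom (fobj H {}) x x = top"
proof -
  let ?i = "\<lambda>x\<in>{}::'u set. x" and ?k = "unit_cocone (discrete {}) {}"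
  obtain g where g: "g \<in> vfun (fobj L (discrete {})) (fobj H {})"
    and gx: "\<forall>x\<in>Obj (fobj H {}). g (\<eta> {} x) = x"
    using iso by (auto simp: vcat_iso_def)
  have "top = Hom (ihom (discrete {}) (discrete {} :: ('u, 'v) vcat)) ?i ?i"
    by simp
  also have "\<dots> \<le> Hom (ihom (fobj H {}) (fobj L (discrete {}))) (?k ?i) (?k ?i)"
    by (rule vfun_Hom[OF cocones_vfun[OF unit_cocone_cocones[OF empty_in] empty_in]])
      (simp_all add: vfun_discrete vcategory_discrete restrict_def)
  also have "\<dots> \<le> Hom (fobj L (discrete {})) (\<eta> {} x) (\<eta> {} x)"
    using x by (simp only: unit_cocone_id[OF empty_in] Hom_ihom) (rule INF_lower)
  also have "\<dots> \<le> Hom (fobj H {}) (g (\<eta> {} x)) (g (\<eta> {} x))"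
    using vfun_Obj[OF unit_vfun[OF empty_in] x] by (intro vfun_Hom[OF g])
  finally show ?thesis
    using gx x by (simp add: top_unique)
qed

lemma unit_iso_if_empty_self_distance_top:
  assumes top: "\<forall>x\<in>Obj (fobj H {}). Hom (fobj H {}) x x = top" and X: "X \<in> \<U>"
  shows "vcat_iso (fobj H X) (fobj L (discrete X)) (\<eta> X)"
proof -
  let ?D = "discrete X :: ('u, 'v) vcat"
  let ?c = "fobj L ?D" and ?k = "unit_cocone ?D"
  note k = unit_cocone_cocones[OF X]
  have c: "vcategory ?c" "Obj ?c \<in> \<U>"
    and iso: "\<And>Z. vcategory Z \<Longrightarrow> Obj Z \<in> \<U> \<Longrightarrow> vcat_iso (ihom ?c Z)
        (nat_trans (ecat_op (SetE \<U>)) (VCat UNIV) (weight ?D) (hom_into (SetE \<U>) (VCat \<U>) H Z))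
        (\<lambda>g\<in>vfun ?c Z. whisker ?D ?k g)"
    using unit_cocone_colimit[OF X] by (auto simp: weighted_colimit_weight_iff)
  \<comment> \<open>Existence and uniqueness of factorisations through the colimit cocone are the
    two halves of bijectivity of whiskering.\<close>
  have surj: "\<exists>g\<in>vfun ?c Z. whisker ?D ?k g = \<alpha>"
    if Z: "vcategory Z" "Obj Z \<in> \<U>" and \<alpha>: "\<alpha> \<in> cocones ?D Z" for Z \<alpha>
  proof -
    obtain \<Psi> where \<Psi>: "\<Psi> \<in> vfun (nat_trans (ecat_op (SetE \<U>)) (VCat UNIV) (weight ?D)
        (hom_into (SetE \<U>) (VCat \<U>) H Z)) (ihom ?c Z)"
      and "\<forall>\<alpha>\<in>cocones ?D Z. (\<lambda>g\<in>vfun ?c Z. whisker ?D ?k g) (\<Psi> \<alpha>) = \<alpha>"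
      using iso[OF Z] unfolding vcat_iso_def Obj_nat_trans_weight by blast
    moreover have "\<Psi> \<alpha> \<in> vfun ?c Z"
      using vfun_Obj[OF \<Psi>] \<alpha> by (simp add: Obj_nat_trans_weight)
    ultimately show ?thesis
      using \<alpha> by (intro bexI[of _ "\<Psi> \<alpha>"]) (metis restrict_apply')
  qed
  have inj: "g = g'"
    if Z: "vcategory Z" "Obj Z \<in> \<U>" and g: "g \<in> vfun ?c Z" "g' \<in> vfun ?c Z"
      and eq: "whisker ?D ?k g = whisker ?D ?k g'" for Z g g'
  proof -
    obtain \<Psi> where "\<forall>g\<in>vfun ?c Z. \<Psi> ((\<lambda>g\<in>vfun ?c Z. whisker ?D ?k g) g) = g"
      using iso[OF Z] unfolding vcat_iso_def Obj_ihom by blast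
    then show ?thesis
      using g eq by (metis restrict_apply')
  qed
  \<comment> \<open>The factorisation of the cocone with vertex \<open>H X\<close>; evaluated at the
    identity of \<open>X\<close>, it shows that \<open>g\<close> is a left inverse of the
    unit.\<close>
  obtain g where g: "g \<in> vfun ?c (fobj H X)" and wg: "whisker ?D ?k g = lan_cocone ?D"
    using surj[OF H_vcategory[OF X] H_Obj[OF X] lan_cocone_discrete[OF top X]] by blast
  have g\<kappa>: "compose (Obj (fobj H Y)) g (?k Y h) = fmap H Y X h" if "Y \<in> \<U>" "h \<in> Y \<rightarrow>\<^sub>E X" for Y h
    using fun_cong[OF fun_cong[OF wg, of Y], of h] that
    by (simp add: whisker_def lan_cocone_def vfun_discrete vcategory_discrete)
  have "compose (Obj (fobj H X)) g (\<eta> X) = (\<lambda>x\<in>Obj (fobj H X). x)"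
    using g\<kappa>[OF X, of "\<lambda>x\<in>X. x"] X by (simp add: unit_cocone_id H_id)
  then have left: "\<forall>x\<in>Obj (fobj H X). g (\<eta> X x) = x"
    by (auto simp: compose_def fun_eq_iff restrict_def split: if_splits)
  let ?e = "compose (Obj ?c) (\<eta> X) g"
  have e: "?e \<in> vfun ?c ?c"
    by (rule vfun_compose[OF g unit_vfun[OF X]])
  \<comment> \<open>An endomorphism of a colimit that fixes the colimit cocone is the identity, so
    \<open>g\<close> is also a right inverse.\<close>
  have "whisker ?D ?k ?e = whisker ?D ?k (\<lambda>x\<in>Obj ?c. x)"
  proof (rule cocones_eqI[OF whisker_cocones[OF k e] whisker_cocones[OF k vfun_id]])
    fix Y h assume Y: "Y \<in> \<U>" and h: "h \<in> vfun (discrete Y) ?D"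
    have h': "h \<in> Y \<rightarrow>\<^sub>E X"
      using h by (simp add: vfun_discrete vcategory_discrete)
    have kYh: "?k Y h x \<in> Obj ?c" if "x \<in> Obj (fobj H Y)" for x
      by (rule vfun_Obj[OF cocones_Obj[OF k Y h] that])
    have "?e (?k Y h x) = ?k Y h x" if x: "x \<in> Obj (fobj H Y)" for x
    proof -
      have "?e (?k Y h x) = \<eta> X (compose (Obj (fobj H Y)) g (?k Y h) x)"
        using kYh x by (simp add: compose_eq)
      also have "\<dots> = \<eta> X (fmap H Y X h x)"
        by (simp only: g\<kappa>[OF Y h'])
      also have "\<dots> = ?k Y h x"
        using x by (simp add: unit_cocone_apply[OF X Y h'] compose_eq)
      finally show ?thesis .
    qed
    then show "whisker ?D ?k ?e Y h = whisker ?D ?k (\<lambda>x\<in>Obj ?c. x) Y h"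
      using Y h kYh by (simp add: whisker_def) (auto simp: compose_def fun_eq_iff)
  qed
  then have "?e = (\<lambda>x\<in>Obj ?c. x)"
    by (rule inj[OF c e vfun_id])
  then have "\<forall>y\<in>Obj ?c. \<eta> X (g y) = y"
    by (auto simp: compose_def fun_eq_iff restrict_def split: if_splits)
  then show ?thesis
    using unit_vfun[OF X] g left by (auto simp: vcat_iso_def)
qed

end

section \<open>Constants and nerves of sets\<close>

lemma Obj_constants_iff:
  "\<tau> \<in> Obj (constants \<U> pt H) \<longleftrightarrow>
    \<tau> \<in> (\<Pi>\<^sub>E X\<in>\<U>. vfun (unit_vcat pt) (fobj H X)) \<and>
    (\<forall>X\<in>\<U>. \<forall>Y\<in>\<U>. \<forall>f\<in>X \<rightarrow>\<^sub>E Y. fmap H X Y f (\<tau> X pt) = \<tau> Y pt)"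
proof -
  have "(compose {pt} (fmap H X Y f) (\<tau> X) = compose {pt} (\<tau> Y) (\<lambda>x\<in>{pt}. x)) \<longleftrightarrow>
      fmap H X Y f (\<tau> X pt) = \<tau> Y pt" for X Y f
    by (auto simp: compose_def fun_eq_iff)
  then show ?thesis
    by (simp add: constants_def nat_trans_def efun_const_def SetE_simps VCat_simps)
      (auto simp: unit_vcat_def)
qed

lemma Hom_constants:
  "Hom (constants \<U> pt H) \<sigma> \<tau> = (INF X\<in>\<U>. Hom (fobj H X) (\<sigma> X pt) (\<tau> X pt))"
  by (simp add: constants_def nat_trans_def efun_const_def SetE_simps VCat_simps)
    (simp add: unit_vcat_def)

lemma vfun_unit_vcat_Obj: "f \<in> vfun (unit_vcat pt) A \<Longrightarrow> f pt \<in> Obj A"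
  using vfun_Obj[of f "unit_vcat pt" A pt] by (simp add: unit_vcat_def)

text \<open>Constants correspond to elements of \<open>H {}\<close>, since the empty set maps
  uniquely to every set. Self-distances do not decrease along the images of these maps, so the
  infimum over all sets is attained at the empty set.\<close>

lemma constants_self_distance_top_iff:
  "(\<forall>\<tau>\<in>Obj (constants \<U> pt H). Hom (constants \<U> pt H) \<tau> \<tau> = top) \<longleftrightarrow>
    (\<forall>x\<in>Obj (fobj H {}). Hom (fobj H {}) x x = top)"
proof (intro iffI ballI)
  fix \<tau> assume top: "\<forall>x\<in>Obj (fobj H {}). Hom (fobj H {}) x x = top"
    and "\<tau> \<in> Obj (constants \<U> pt H)"
  then have \<tau>: "\<tau> \<in> (\<Pi>\<^sub>E X\<in>\<U>. vfun (unit_vcat pt) (fobj H X))"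
    "\<forall>X\<in>\<U>. \<forall>Y\<in>\<U>. \<forall>f\<in>X \<rightarrow>\<^sub>E Y. fmap H X Y f (\<tau> X pt) = \<tau> Y pt"
    unfolding Obj_constants_iff by blast+
  have "\<tau> {} pt \<in> Obj (fobj H {})"
    using \<tau>(1) empty_in by (auto intro: vfun_unit_vcat_Obj)
  then have "top \<le> Hom (fobj H X) (\<tau> X pt) (\<tau> X pt)" if "X \<in> \<U>" for X
    using vfun_Hom[OF H_map[OF empty_in that empty_map[OF that]], of "\<tau> {} pt" "\<tau> {} pt"]
      \<tau>(2) empty_in that top empty_map[OF that] by metis
  then show "Hom (constants \<U> pt H) \<tau> \<tau> = top"
    by (simp add: Hom_constants top_unique)
next
  fix x assume top: "\<forall>\<tau>\<in>Obj (constants \<U> pt H). Hom (constants \<U> pt H) \<tau> \<tau> = top"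
    and x: "x \<in> Obj (fobj H {})"
  \<comment> \<open>The constant generated by \<open>x\<close>: push \<open>x\<close> forward along
    the unique map from the empty set to each \<open>X\<close>.\<close>
  define \<tau> where "\<tau> = (\<lambda>X\<in>\<U>. \<lambda>_\<in>{pt}. fmap H {} X (\<lambda>_. undefined) x)"
  have Hx: "fmap H {} X (\<lambda>_. undefined) x \<in> Obj (fobj H X)" if "X \<in> \<U>" for X
    using H_map_Obj[OF empty_in that empty_map[OF that] x] .
  have "\<tau> X \<in> vfun (unit_vcat pt) (fobj H X)" if "X \<in> \<U>" for X
    using that Hx
    by (intro vfunI) (auto simp: \<tau>_def unit_vcat_def vcategory_refl H_vcategory)
  moreover have "fmap H X Y f (\<tau> X pt) = \<tau> Y pt" if "X \<in> \<U>" "Y \<in> \<U>" "f \<in> X \<rightarrow>\<^sub>E Y" for X Y f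
    using H_compose_apply[OF empty_in that(1,2) empty_map[OF that(1)] that(3) x] that
    by (simp add: \<tau>_def compose_def restrict_def)
  ultimately have "\<tau> \<in> Obj (constants \<U> pt H)"
    by (auto simp: Obj_constants_iff) (simp add: \<tau>_def)
  then have "top = (INF X\<in>\<U>. Hom (fobj H X) (\<tau> X pt) (\<tau> X pt))"
    using top by (simp only: Hom_constants)
  also have "\<dots> \<le> Hom (fobj H {}) (\<tau> {} pt) (\<tau> {} pt)"
    by (rule INF_lower[OF empty_in])
  finally have "top \<le> Hom (fobj H {}) (\<tau> {} pt) (\<tau> {} pt)" .
  moreover have "\<tau> {} pt = x"
    using empty_in x by (simp add: \<tau>_def empty_map_id H_id)
  ultimately show "Hom (fobj H {}) x x = top"
    by (simp add: top_unique)
qed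

text \<open>The nerve of the empty set is empty at every level, so level \<open>top\<close> forces
  the self-distances. Conversely, the nerve projections are two maps into \<open>X\<close> at
  distance at least \<open>r\<close>, and \<open>INF_discrete_le\<close> applies.\<close>

lemma preserves_nerves_of_sets_iff:
  "preserves_nerves_of_sets \<U> pair p0 p1 H \<longleftrightarrow>
    (\<forall>x\<in>Obj (fobj H {}). Hom (fobj H {}) x x = top)"
proof
  assume "preserves_nerves_of_sets \<U> pair p0 p1 H"
  then have "top \<le> (INF C\<in>Obj (fobj H {}).
      Hom (fobj H {}) (fmap H {} {} (\<lambda>x\<in>{}. x) C) (fmap H {} {} (\<lambda>x\<in>{}. x) C))"
    using empty_in unfolding preserves_nerves_of_sets_def Let_def
    by (force simp: nerve_def restrict_def dest!: bspec[of _ _ "{}"] spec[of _ top])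
  then show "\<forall>x\<in>Obj (fobj H {}). Hom (fobj H {}) x x = top"
    using empty_in by (auto simp: H_id top_unique le_INF_iff)
next
  assume top: "\<forall>x\<in>Obj (fobj H {}). Hom (fobj H {}) x x = top"
  have "r \<le> Hom (fobj H X) (fmap H N X (restrict p0 N) C) (fmap H N X (restrict p1 N) C)"
    if X: "X \<in> \<U>" and N_def: "N = nerve pair (discrete X) r" and C: "C \<in> Obj (fobj H N)"
    for X r N C
  proof -
    have "r \<le> (INF y\<in>N. Hom (discrete X :: ('u, 'v) vcat) (restrict p0 N y) (restrict p1 N y))"
      by (auto simp: N_def nerve_def p0_pair p1_pair intro!: INF_greatest)
    also have "\<dots> \<le> Hom (fobj H X) (fmap H N X (restrict p0 N) C) (fmap H N X (restrict p1 N) C)"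
      using nerve_in[of "discrete X" r] nerve_projections[of "discrete X" r] X
      by (intro INF_discrete_le[OF top X _ _ _ C]) (simp_all only: N_def Obj_discrete)
    finally show ?thesis .
  qed
  then show "preserves_nerves_of_sets \<U> pair p0 p1 H"
    by (auto simp: preserves_nerves_of_sets_def Let_def intro!: INF_greatest)
qed

end

theorem theorem3p20:
  fixes \<U> :: "'u set set"
    and pt :: 'u
    and pair :: "'u \<Rightarrow> 'u \<Rightarrow> 'u"
    and p0 p1 :: "'u \<Rightarrow> 'u"
    and H :: "('u set, 'u \<Rightarrow> 'u, ('u, 'v::commutative_quantale) vcat, 'u \<Rightarrow> 'u) efun"
  assumes "set_universe \<U> pt pair p0 p1"
    and "efunctor (SetE \<U>) (VCat \<U>) H"
  shows "(\<exists>L \<eta>. is_Lan \<U> H L \<eta>) \<and>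
    (\<forall>L \<eta>. is_Lan \<U> H L \<eta> \<longrightarrow>
      (let c1 = (\<forall>X\<in>\<U>. vcat_iso (fobj H X) (fobj L (discrete X)) (\<eta> X));
           c2 = (\<forall>x\<in>Obj (fobj H {}). Hom (fobj H {}) x x = top);
           c3 = (\<forall>\<tau>\<in>Obj (constants \<U> pt H). Hom (constants \<U> pt H) \<tau> \<tau> = top);
           c4 = preserves_nerves_of_sets \<U> pair p0 p1 H
       in (c1 \<longleftrightarrow> c2) \<and> (c2 \<longleftrightarrow> c3) \<and> (c3 \<longleftrightarrow> c4) \<and>
          (integral_quantale TYPE('v) \<or> Obj (fobj H {}) = {} \<longrightarrow> c1 \<and> c2 \<and> c3 \<and> c4)))"
proof -
  interpret set_vcat_functor \<U> pt pair p0 p1 H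
    using assms by (simp add: set_vcat_functor_def set_vcat_functor_axioms_def)
  let ?c2 = "\<forall>x\<in>Obj (fobj H {}). Hom (fobj H {}) x x = top"
  have unit_iff: "(\<forall>X\<in>\<U>. vcat_iso (fobj H X) (fobj L (discrete X)) (\<eta> X)) \<longleftrightarrow> ?c2"
    if "is_Lan \<U> H L \<eta>" for L \<eta>
    using empty_self_distance_top_if_unit_iso[OF that]
      unit_iso_if_empty_self_distance_top[OF that] empty_in by blast
  \<comment> \<open>In the integral case \<open>1 = top\<close> lies below every self-distance; in
    the other case the quantifier is vacuous.\<close>
  have "?c2" if "integral_quantale TYPE('v) \<or> Obj (fobj H {}) = {}"
    using that
  proof
    assume "integral_quantale TYPE('v)"
    then show ?thesis
      using vcategory_refl[OF H_vcategory[OF empty_in]]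
      by (metis integral_quantale_def top_unique)
  qed simp
  then show ?thesis
    using is_Lan_lan unit_iff
    by (simp add: Let_def constants_self_distance_top_iff preserves_nerves_of_sets_iff) blast
qed

end
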